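(* Let $f\in W^3_\infty(\mathbb{R})$ and $\tau>0$. There is a constant $c_{f,\tau}>0$, depending on $f$ and $\tau$ but independent of $k_0$, such that the following holds. Let $k_0\in\mathbb{Z}_+$, let $\{S_k\}$ be the NUCC scheme with the alternative masks (defined in the context) acting on the initial data $\mathbf{f}^0=\{f(2^{-k_0}(n-\tfrac12)):n\in\mathbb{Z}\}$, and let $\mathbf{f}^\infty=\lim_{k\to\infty}S_k\cdots S_0\mathbf{f}^0$ be the limit function. Let $\overline{t}=2^{-k_0}t^{k+1}_j$ (with $k\in\mathbb{Z}_+$, $j\in\mathbb{Z}$) be a dyadic point. If $|f'(t)|\ge\tau$ for all $t$ with $|t-\overline{t}|\le2^{-k_0-k}$, then $$|\mathbf{f}^\infty(\overline{t})-f(\overline{t})|\le c_{f,\tau}\,2^{-3k_0}.$$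
   Context: Notation. $\mathbb{Z}_+$ is the set of nonnegative integers; $t^k_j:=2^{-k}(j-\tfrac12)$; $W^3_\infty(\mathbb{R})$ is the space of $f:\mathbb{R}\to\mathbb{R}$ with $\sum_{n=0}^3\|f^{(n)}\|_\infty<\infty$. A linear non-uniform subdivision operator $S_k$ with masks $\mathbf{a}^{j,k}=\{\mathbf{a}^{j,k}_n:n\in\mathbb{Z}\}$ acts on real sequences $\mathbf{g}$ by $(S_k\mathbf{g})_{2j+\nu}=\sum_{i\in\mathbb{Z}}\mathbf{a}^{j,k}_{2i+\nu}\mathbf{g}_{j-i}$, $\nu=0,1$. $S_{\mathbf a}$ is the classical corner-cutting operator, with mask $\mathbf{a}_{-2}=\tfrac14,\ \mathbf{a}_{-1}=\mathbf{a}_0=\tfrac34,\ \mathbf{a}_1=\tfrac14$ (other entries zero) for all $j,k$. The NUCC scheme with the alternative masks acting on $\mathbf{f}^0$. Put $\mathbf{d}^0_j:=\mathbf{f}^0_{j-1}-2\mathbf{f}^0_j+\mathbf{f}^0_{j+1}$ and $\mathbf{d}^k:=S_{\mathbf a}^k\mathbf{d}^0$. The operators $S_k$ and data $\mathbf{f}^{k+1}:=S_k\mathbf{f}^k$ are built recursively: for $j\in\mathbb{Z}$, $\nu\in\{0,1\}$, let $$\gamma_{2j+\nu}=\gamma_{2j+\nu,k}:=\frac{\mathbf{d}^k_{j+\nu}}{\nabla\mathbf{f}^k_{j+1}+\epsilon},\qquad \nabla\mathbf{f}^k_{j+1}:=2^k(\mathbf{f}^k_{j+1}-\mathbf{f}^k_j),$$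 where $|\epsilon|=2^{-2k_0}$ and the sign of $\epsilon$ is that of $\nabla\mathbf{f}^k_{j+1}$ (either sign if it is zero). The only nonzero mask entries are $$\mathbf{a}^{j,k}_{-2}=\frac{e^{\frac14\gamma_{2j}2^{-k}}-1}{e^{\gamma_{2j}2^{-k}}-1},\quad \mathbf{a}^{j,k}_{-1}=\frac{e^{\frac34\gamma_{2j+1}2^{-k}}-1}{e^{\gamma_{2j+1}2^{-k}}-1},\quad \mathbf{a}^{j,k}_0=1-\mathbf{a}^{j,k}_{-2},\quad \mathbf{a}^{j,k}_1=1-\mathbf{a}^{j,k}_{-1},$$ with the quotients replaced by their limits $\tfrac14,\tfrac34$ when $\gamma=0$. Standing assumptions. The shape parameters are uniformly bounded, and $\mathbf{a}_n-\tfrac14<\mathbf{a}^{j,k}_n<\mathbf{a}_n+\tfrac14$ for all $j,k$ and $n\in\{-2,-1,0,1\}$. Limit function. The value $\mathbf{f}^k_j$ is attached to the point $2^{-k_0}t^k_j$; $\mathbf{f}^\infty\in C(\mathbb{R})$ is the function with $\lim_{k\to\infty}\sup_{j\in\mathbb{Z}\cap2^k\Omega}|\mathbf{f}^k_j-\mathbf{f}^\infty(2^{-k_0}t^k_j)|=0$ for every compact $\Omega\subset\mathbb{R}$. *)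

theory Defs
  imports "HOL-Analysis.Analysis" "HOL-Probability.Essential_Supremum"
begin

text \<open>
  The space \<open>W\<^sup>r\<^sub>\<infinity>(\<real>)\<close>, as the functions with \<open>f\<^sup>(\<^sup>r\<^sup>-\<^sup>1\<^sup>)\<close> locally absolutely
  continuous and \<open>\<Sum>n\<le>r. \<parallel>f\<^sup>(\<^sup>n\<^sup>)\<parallel>\<^sub>\<infinity> < \<infinity>\<close>: here \<open>g n\<close> is \<open>f\<^sup>(\<^sup>n\<^sup>)\<close>. The integral identity for \<open>n + 1 < r\<close>
  makes \<open>g (n + 1)\<close> the classical derivative of \<open>g n\<close>; only \<open>g r\<close> is a derivative merely almost
  everywhere. As \<open>esssup\<close> of a non-measurable function is \<open>\<infinity>\<close>, measurability is implied.
\<close>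

definition sobolev_inf :: "nat \<Rightarrow> (real \<Rightarrow> real) \<Rightarrow> bool" where
  "sobolev_inf r f \<longleftrightarrow>
     (\<exists>g :: nat \<Rightarrow> real \<Rightarrow> real.
        g 0 = f \<and>
        (\<forall>n<r. \<forall>a b. a \<le> b \<longrightarrow> (g (Suc n) has_integral (g n b - g n a)) {a..b}) \<and>
        (\<Sum>n\<le>r. esssup lebesgue (\<lambda>x. ereal \<bar>g n x\<bar>)) < \<infinity>)"

definition grid_pt :: "nat \<Rightarrow> int \<Rightarrow> real" where
  "grid_pt k j = (real_of_int j - 1/2) / 2 ^ k"

text \<open>The index \<open>2j + \<nu>\<close> with \<open>\<nu> \<in> {0, 1}\<close> is written \<open>m\<close>, so that \<open>j = m div 2\<close> and \<open>\<nu> = m mod 2\<close>.\<close>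

definition subdiv :: "(int \<Rightarrow> int \<Rightarrow> real) \<Rightarrow> (int \<Rightarrow> real) \<Rightarrow> int \<Rightarrow> real" where
  "subdiv a g m = (\<Sum>\<^sub>\<infinity>i\<in>UNIV. a (m div 2) (2 * i + m mod 2) * g (m div 2 - i))"

lemma subdiv_index:
  assumes "\<nu> \<in> {0, 1}"
  shows "subdiv a g (2 * j + \<nu>) = (\<Sum>\<^sub>\<infinity>i\<in>UNIV. a j (2 * i + \<nu>) * g (j - i))"
proof -
  have "(2 * j + \<nu>) div 2 = j" "(2 * j + \<nu>) mod 2 = \<nu>"
    using assms by auto
  then show ?thesis by (simp add: subdiv_def)
qed

definition cc_mask :: "int \<Rightarrow> real" where
  "cc_mask n = (if n = -2 \<or> n = 1 then 1/4 else if n = -1 \<or> n = 0 then 3/4 else 0)"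

definition second_diff :: "(int \<Rightarrow> real) \<Rightarrow> int \<Rightarrow> real" where
  "second_diff g j = g (j - 1) - 2 * g j + g (j + 1)"

definition cc_data :: "(int \<Rightarrow> real) \<Rightarrow> nat \<Rightarrow> int \<Rightarrow> real" where
  "cc_data d0 k = (subdiv (\<lambda>_. cc_mask) ^^ k) d0"

definition scaled_diff :: "nat \<Rightarrow> (int \<Rightarrow> real) \<Rightarrow> int \<Rightarrow> real" where
  "scaled_diff k g j = 2 ^ k * (g j - g (j - 1))"

text \<open>
  The perturbation \<open>\<epsilon>\<close> for the difference \<open>x\<close>; \<open>s \<in> {-1, 1}\<close> is the sign chosen if \<open>x = 0\<close>.
\<close>

definition perturb :: "nat \<Rightarrow> real \<Rightarrow> real \<Rightarrow> real" where
  "perturb k0 s x = (if x = 0 then s else sgn x) / 2 ^ (2 * k0)"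

text \<open>The level \<open>k\<close> shape parameters \<open>\<gamma>\<^sub>m\<close> from \<open>g = f\<^sup>k\<close> and \<open>d = d\<^sup>k\<close>; \<open>s m\<close> is the sign choice above.\<close>

definition alt_shape ::
  "nat \<Rightarrow> nat \<Rightarrow> (int \<Rightarrow> real) \<Rightarrow> (int \<Rightarrow> real) \<Rightarrow> (int \<Rightarrow> real) \<Rightarrow> int \<Rightarrow> real" where
  "alt_shape k0 k s d g m =
     (let x = scaled_diff k g (m div 2 + 1)
      in d (m div 2 + m mod 2) / (x + perturb k0 (s m) x))"

definition exp_quot :: "real \<Rightarrow> real \<Rightarrow> real" where
  "exp_quot \<theta> x = (if x = 0 then \<theta> else (exp (\<theta> * x) - 1) / (exp x - 1))"

definition nucc_mask :: "nat \<Rightarrow> (int \<Rightarrow> real) \<Rightarrow> int \<Rightarrow> int \<Rightarrow> real" where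
  "nucc_mask k \<gamma> j n =
     (if n = -2 then exp_quot (1/4) (\<gamma> (2 * j) / 2 ^ k)
      else if n = -1 then exp_quot (3/4) (\<gamma> (2 * j + 1) / 2 ^ k)
      else if n = 0 then 1 - exp_quot (1/4) (\<gamma> (2 * j) / 2 ^ k)
      else if n = 1 then 1 - exp_quot (3/4) (\<gamma> (2 * j + 1) / 2 ^ k)
      else 0)"

text \<open>
  The data \<open>f\<^sup>k\<close> of the scheme with the alternative masks, started from \<open>f0\<close>;
  \<open>\<sigma> k m\<close> is the sign of \<open>\<epsilon>\<close> used in \<open>\<gamma>\<^sub>m\<close> at level \<open>k\<close> where the difference vanishes.
\<close>

primrec nucc_data ::
  "nat \<Rightarrow> (nat \<Rightarrow> int \<Rightarrow> real) \<Rightarrow> (int \<Rightarrow> real) \<Rightarrow> nat \<Rightarrow> int \<Rightarrow> real" where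
  "nucc_data k0 \<sigma> f0 0 = f0"
| "nucc_data k0 \<sigma> f0 (Suc k) =
     subdiv
       (nucc_mask k
         (alt_shape k0 k (\<sigma> k) (cc_data (second_diff f0) k) (nucc_data k0 \<sigma> f0 k)))
       (nucc_data k0 \<sigma> f0 k)"

definition nucc_shape ::
  "nat \<Rightarrow> (nat \<Rightarrow> int \<Rightarrow> real) \<Rightarrow> (int \<Rightarrow> real) \<Rightarrow> nat \<Rightarrow> int \<Rightarrow> real" where
  "nucc_shape k0 \<sigma> f0 k =
     alt_shape k0 k (\<sigma> k) (cc_data (second_diff f0) k) (nucc_data k0 \<sigma> f0 k)"

definition standing_assumptions ::
  "nat \<Rightarrow> (nat \<Rightarrow> int \<Rightarrow> real) \<Rightarrow> (int \<Rightarrow> real) \<Rightarrow> bool" where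
  "standing_assumptions k0 \<sigma> f0 \<longleftrightarrow>
     (\<exists>B. \<forall>k m. \<bar>nucc_shape k0 \<sigma> f0 k m\<bar> \<le> B) \<and>
     (\<forall>k j. \<forall>n\<in>{-2, -1, 0, 1}.
        cc_mask n - 1/4 < nucc_mask k (nucc_shape k0 \<sigma> f0 k) j n \<and>
        nucc_mask k (nucc_shape k0 \<sigma> f0 k) j n < cc_mask n + 1/4)"

text \<open>The supremum is taken in \<open>ennreal\<close> so that it is \<open>0\<close> over an empty index set.\<close>

definition is_limit_function ::
  "nat \<Rightarrow> (nat \<Rightarrow> int \<Rightarrow> real) \<Rightarrow> (real \<Rightarrow> real) \<Rightarrow> bool" where
  "is_limit_function k0 F f_inf \<longleftrightarrow>
     continuous_on UNIV f_inf \<and>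
     (\<forall>\<Omega> :: real set. compact \<Omega> \<longrightarrow>
        (\<lambda>k. SUP j \<in> {j :: int. real_of_int j \<in> (\<lambda>x. 2 ^ k * x) ` \<Omega>}.
               ennreal \<bar>F k j - f_inf (grid_pt k j / 2 ^ k0)\<bar>) \<longlonglongrightarrow> 0)"

end

theory Submission
  imports Defs
begin

text \<open>
  Write \<open>h = 2\<^sup>-\<^sup>k\<^sup>0\<close>. Expanding the exponential quotient to second order in the shape parameter turns one
  step of the scheme into corner cutting with the extra term \<open>-(3/32) 4\<^sup>-\<^sup>k d\<^sup>k\<close>, up to a remainder.
  That extra term is what makes the scheme accurate to third order. Corner cutting alone misplaces a
  quadratic by \<open>(3/32) (h 2\<^sup>-\<^sup>k)\<^sup>2 f''\<close>, while corner cutting of second differences keeps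
  \<open>d\<^sup>k = h\<^sup>2 f'' + O(h\<^sup>3)\<close> at all levels, because \<open>f''\<close> is Lipschitz (lemma \<open>d_approx\<close>). So the
  two cancel up to \<open>O(4\<^sup>-\<^sup>k h\<^sup>3)\<close>.

  The remainder is of size \<open>4\<^sup>-\<^sup>k (\<bar>d\<^sup>k\<bar> h\<^sup>2 + (d\<^sup>k)\<^sup>2) / \<bar>D\<bar>\<close>, where \<open>D\<close> is the scaled first difference; it is
  \<open>O(4\<^sup>-\<^sup>k h\<^sup>3)\<close> as soon as \<open>\<bar>D\<bar>\<close> is at least a multiple of \<open>h\<close> (lemmas \<open>increment_expansion\<close> and
  \<open>F_step_error\<close>). The main difficulty is therefore to keep the differences away from \<open>0\<close> at every level,
  and the error bound is too weak for this when \<open>2\<^sup>-\<^sup>k\<close> is much smaller than \<open>h\<^sup>2\<close>. A direct recursion works: as \<open>\<epsilon>\<close> has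
  the sign of \<open>D\<close>, \<open>\<bar>D / (D + \<epsilon>)\<bar> \<le> 1\<close>, so that replacing the true weights by those of corner
  cutting alters a scaled difference by only \<open>O(2\<^sup>-\<^sup>k h\<^sup>2)\<close>, however small \<open>D\<close> is. Summed over the levels, the differences lose
  \<open>O(h\<^sup>2)\<close>, and they start at \<open>h \<tau> / 2\<close> or more (lemma \<open>D_lower_bound\<close>).

  The data at level \<open>k\<close> near a point depend only on data at coarser levels \<open>l\<close> within a distance
  \<open>2 \<cdot> 2\<^sup>-\<^sup>l\<close> (in units of \<open>h\<close>), so these arguments run in shrinking windows around the point. As \<open>f'\<close> is
  Lipschitz, \<open>\<bar>f'\<bar> \<ge> \<tau>\<close> at the centre gives \<open>\<bar>f'\<bar> \<ge> \<tau> / 2\<close> on the coarsest window, whose length is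
  \<open>4 h\<close>, if \<open>h\<close> is small compared with \<open>\<tau>\<close>; for the remaining \<open>h\<close> the bound
  \<open>\<bar>f\<^sup>k\<bar> \<le> \<parallel>f\<parallel>\<^sub>\<infinity>\<close> suffices, as \<open>h\<close> is bounded below. Summing the local errors gives
  \<open>\<bar>f\<^sup>k - f\<bar> = O(h\<^sup>3)\<close> in all windows, and \<open>k \<rightarrow> \<infinity>\<close> transfers this to the limit function.
\<close>

section \<open>Expansion of the exponential quotient\<close>

lemma exp_remainder_cubic:
  fixes y :: real assumes "\<bar>y\<bar> \<le> 1"
  shows "\<bar>exp y - 1 - y - y\<^sup>2 / 2\<bar> \<le> \<bar>y\<bar> ^ 3 / 2"
proof -
  obtain t where t: "\<bar>t\<bar> \<le> \<bar>y\<bar>" "exp y = (\<Sum>m<3. y ^ m / fact m) + exp t / fact 3 * y ^ 3"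
    using Maclaurin_exp_le[of y 3] by auto
  have "exp t \<le> exp 1" using t assms by simp
  then have "exp t \<le> 3" using exp_le by linarith
  have "exp y - 1 - y - y\<^sup>2 / 2 = exp t / 6 * y ^ 3"
    using t(2) by (simp add: numeral_eq_Suc)
  then have "\<bar>exp y - 1 - y - y\<^sup>2 / 2\<bar> = exp t / 6 * \<bar>y\<bar> ^ 3"
    by (simp only: abs_mult power_abs) simp
  also have "\<dots> \<le> 1 / 2 * \<bar>y\<bar> ^ 3"
    using \<open>exp t \<le> 3\<close> by (intro mult_right_mono) auto
  finally show ?thesis by simp
qed

lemma abs_exp_minus_one_ge:
  fixes x :: real assumes "\<bar>x\<bar> \<le> 1"
  shows "\<bar>x\<bar> / 2 \<le> \<bar>exp x - 1\<bar>"
proof (cases "x \<ge> 0")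
  case True then show ?thesis using exp_ge_add_one_self[of x] by linarith
next
  case False
  have "1 - x \<le> exp (- x)" using exp_ge_add_one_self[of "-x"] by simp
  then have "(1 - x) * exp x \<le> 1"
    using mult_right_mono[of "1 - x" "exp (-x)" "exp x"] by (simp add: exp_minus)
  moreover have "(1 - x) * (1 + x / 2) \<ge> 1"
  proof -
    have "x * (1 + x) \<le> 0" using False assms by (intro mult_nonpos_nonneg) auto
    then show ?thesis by (simp add: algebra_simps)
  qed
  ultimately have "(1 - x) * exp x \<le> (1 - x) * (1 + x / 2)" by linarith
  then have "exp x \<le> 1 + x / 2" using False by (simp add: mult_le_cancel_left_pos)
  then show ?thesis using False by linarith
qed

text \<open>
  The bounds below hold for all real \<open>x\<close>, although the expansion is only informative for small \<open>x\<close>: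
  where \<open>\<bar>x\<bar> \<ge> 1\<close> they follow from the fact that the quotient lies in the unit interval.
\<close>

lemma exp_quot_in_unit:
  assumes "0 \<le> \<theta>" "\<theta> \<le> 1"
  shows "0 \<le> exp_quot \<theta> x" "exp_quot \<theta> x \<le> 1"
proof -
  consider "x = 0" | "x > 0" | "x < 0" by linarith
  then have "0 \<le> exp_quot \<theta> x \<and> exp_quot \<theta> x \<le> 1"
  proof cases
    case 1 then show ?thesis using assms by (simp add: exp_quot_def)
  next
    case 2
    have "0 \<le> \<theta> * x" "\<theta> * x \<le> x" using assms 2 by (auto simp: mult_left_le_one_le)
    then show ?thesis using 2 by (simp add: exp_quot_def divide_simps)
  next
    case 3
    have "\<theta> * x \<le> 0" "x \<le> \<theta> * x"
      using assms 3 mult_right_mono_neg[of \<theta> 1 x] by (auto simp: mult_nonneg_nonpos)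
    then show ?thesis using 3 by (simp add: exp_quot_def divide_simps)
  qed
  then show "0 \<le> exp_quot \<theta> x" "exp_quot \<theta> x \<le> 1" by auto
qed

text \<open>
  Multiplying the error by \<open>exp x - 1\<close> leaves only terms of third order, since the coefficient
  \<open>\<theta> (\<theta> - 1) / 2\<close> is the one for which the quadratic terms cancel. As
  \<open>\<bar>exp x - 1\<bar>\<close> is comparable to \<open>\<bar>x\<bar>\<close>, dividing costs one order.
\<close>

lemma exp_quot_expansion:
  assumes "0 \<le> \<theta>" "\<theta> \<le> 1"
  shows "\<bar>exp_quot \<theta> x - \<theta> - \<theta> * (\<theta> - 1) / 2 * x\<bar> \<le> 3 * x\<^sup>2"
proof -
  define \<beta> where "\<beta> = \<theta> * (\<theta> - 1) / 2"
  have "\<theta> * (1 - \<theta>) \<ge> 0" using assms by simp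
  moreover have "\<theta> * (1 - \<theta>) \<le> 1 / 4"
    using zero_le_power2[of "\<theta> - 1/2"] by (simp add: power2_eq_square algebra_simps)
  moreover have "\<beta> = - (\<theta> * (1 - \<theta>)) / 2" by (simp add: \<beta>_def algebra_simps)
  ultimately have \<beta>: "\<bar>\<beta>\<bar> \<le> 1 / 8" by linarith
  consider "x = 0" | "\<bar>x\<bar> \<ge> 1" | "x \<noteq> 0" "\<bar>x\<bar> \<le> 1" by linarith
  then have "\<bar>exp_quot \<theta> x - \<theta> - \<beta> * x\<bar> \<le> 3 * x\<^sup>2"
  proof cases
    case 1 then show ?thesis by (simp add: exp_quot_def)
  next
    case 2
    have "\<bar>exp_quot \<theta> x - \<theta>\<bar> \<le> 1" using exp_quot_in_unit[OF assms, of x] assms by linarith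
    moreover have "\<bar>\<beta> * x\<bar> \<le> 1 / 8 * \<bar>x\<bar>"
      unfolding abs_mult using \<beta> by (intro mult_right_mono) auto
    moreover have "\<bar>x\<bar> \<le> x\<^sup>2" using mult_left_mono[OF 2, of "\<bar>x\<bar>"] by (simp add: power2_eq_square)
    ultimately show ?thesis using 2 by linarith
  next
    case 3
    define r where "r y = exp y - 1 - y - y\<^sup>2 / 2" for y :: real
    define A where "A = \<bar>x\<bar> ^ 3"
    have A0: "A \<ge> 0" by (simp add: A_def)
    have \<theta>x: "\<bar>\<theta> * x\<bar> \<le> \<bar>x\<bar>" using assms by (simp add: abs_mult mult_left_le_one_le)
    have r1: "\<bar>r x\<bar> \<le> A / 2" unfolding r_def A_def using exp_remainder_cubic[OF 3(2)] .
    have "\<bar>r (\<theta> * x)\<bar> \<le> \<bar>\<theta> * x\<bar> ^ 3 / 2"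
      unfolding r_def using \<theta>x 3(2) by (intro exp_remainder_cubic) linarith
    also have "\<dots> \<le> A / 2"
      unfolding A_def using power_mono[OF \<theta>x, of 3] by simp
    finally have r2: "\<bar>r (\<theta> * x)\<bar> \<le> A / 2" .
    have r3: "\<bar>\<theta> * r x\<bar> \<le> A / 2"
      using r1 assms mult_left_le_one_le[of "\<bar>r x\<bar>" \<theta>] by (simp add: abs_mult)
    have bx: "\<bar>\<beta> * x\<bar> \<le> 1 / 8"
      using mult_mono[OF \<beta> 3(2)] by (simp add: abs_mult)
    have r4: "\<bar>\<beta> * x * r x\<bar> \<le> A / 16"
      using mult_mono[OF bx r1] by (simp add: abs_mult)
    have r5: "\<bar>\<beta> * x ^ 3 / 2\<bar> \<le> A / 16"
      using mult_right_mono[OF \<beta> A0] by (simp add: abs_mult power_abs A_def)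
    have nz: "exp x - 1 \<noteq> 0" using 3(1) by simp
    have "(exp_quot \<theta> x - \<theta> - \<beta> * x) * (exp x - 1) = exp (\<theta> * x) - 1 - (\<theta> + \<beta> * x) * (exp x - 1)"
      using 3 nz by (simp add: exp_quot_def field_simps)
    also have "\<dots> = r (\<theta> * x) - \<theta> * r x - \<beta> * x ^ 3 / 2 - \<beta> * x * r x"
      unfolding r_def by (simp add: \<beta>_def field_simps power2_eq_square power3_eq_cube)
    finally have "\<bar>exp_quot \<theta> x - \<theta> - \<beta> * x\<bar> * \<bar>exp x - 1\<bar> \<le> 3 / 2 * A"
      unfolding abs_mult[symmetric] using A0 r2 r3 r4 r5 by linarith
    moreover have "\<bar>exp_quot \<theta> x - \<theta> - \<beta> * x\<bar> * (\<bar>x\<bar> / 2) \<le> \<bar>exp_quot \<theta> x - \<theta> - \<beta> * x\<bar> * \<bar>exp x - 1\<bar>"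
      using abs_exp_minus_one_ge[OF 3(2)] by (intro mult_left_mono) auto
    moreover have "3 / 2 * A = 3 * x\<^sup>2 * (\<bar>x\<bar> / 2)"
      by (simp add: A_def power3_eq_cube power2_eq_square)
    ultimately have "\<bar>exp_quot \<theta> x - \<theta> - \<beta> * x\<bar> * (\<bar>x\<bar> / 2) \<le> 3 * x\<^sup>2 * (\<bar>x\<bar> / 2)"
      by linarith
    then show ?thesis using 3(1) by (simp add: mult_le_cancel_right)
  qed
  then show ?thesis by (simp add: \<beta>_def)
qed

lemma exp_quot_deviation:
  assumes "0 \<le> \<theta>" "\<theta> \<le> 1"
  shows "\<bar>exp_quot \<theta> x - \<theta>\<bar> \<le> 4 * \<bar>x\<bar>"
proof (cases "\<bar>x\<bar> \<ge> 1")
  case True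
  have "\<bar>exp_quot \<theta> x - \<theta>\<bar> \<le> 1" using exp_quot_in_unit[OF assms, of x] assms by linarith
  then show ?thesis using True by linarith
next
  case False
  have "\<bar>\<theta> * (\<theta> - 1) / 2\<bar> \<le> 1"
    using assms mult_mono[of \<theta> 1 "1 - \<theta>" 1] by (simp add: abs_mult)
  then have "\<bar>\<theta> * (\<theta> - 1) / 2 * x\<bar> \<le> 1 * \<bar>x\<bar>"
    unfolding abs_mult[of _ x] by (intro mult_right_mono) auto
  moreover have "x\<^sup>2 \<le> \<bar>x\<bar>"
    using False mult_left_mono[of "\<bar>x\<bar>" 1 "\<bar>x\<bar>"] by (simp add: power2_eq_square)
  ultimately show ?thesis using exp_quot_expansion[OF assms, of x] by linarith
qed

section \<open>One refinement step\<close>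

text \<open>
  The relative position of the new point with index \<open>m\<close> between its two parents \<open>m div 2\<close> and
  \<open>m div 2 + 1\<close>. It is at the same time the weight of the right parent in corner cutting, which is why
  corner cutting reproduces linear data.
\<close>

definition cut :: "int \<Rightarrow> real" where
  "cut m = 1/4 + of_int (m mod 2) / 2"

lemma cut_even [simp]: "cut (2 * j) = 1/4"
  and cut_odd [simp]: "cut (2 * j + 1) = 3/4"
  by (simp_all add: cut_def)

lemma cut_range: "0 \<le> cut m" "cut m \<le> 1"
  by (cases "even m"; auto elim!: evenE oddE)+

lemma cut_correction: "cut m * (cut m - 1) / 2 = - 3 / 32"
  by (cases "even m") (auto elim!: evenE oddE)

lemma subdiv_four_point:
  assumes "\<And>n. n \<notin> {-2, -1, 0, 1} \<Longrightarrow> a (m div 2) n = 0"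
  shows "subdiv a g m =
           a (m div 2) (m mod 2 - 2) * g (m div 2 + 1) + a (m div 2) (m mod 2) * g (m div 2)"
proof -
  define T where "T = (\<lambda>i. a (m div 2) (2 * i + m mod 2) * g (m div 2 - i))"
  have "T i = 0" if "i \<notin> {-1, 0}" for i
  proof -
    have "2 * i + m mod 2 \<notin> {-2, -1, 0, 1}" using that by simp presburger
    then show ?thesis by (simp add: T_def assms)
  qed
  then have "infsum T UNIV = infsum T {-1, 0}"
    by (intro infsum_cong_neutral) auto
  then have "infsum T UNIV = T (-1) + T 0" by simp
  moreover have "subdiv a g m = infsum T UNIV" by (simp add: T_def subdiv_def)
  ultimately show ?thesis by (simp add: T_def algebra_simps)
qed

text \<open>
  Both refinement rules are interpolations between the two parents, and the even and the odd rule
  need not be distinguished once the weight is written in terms of \<open>cut m\<close>.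
\<close>

lemma cc_mask_cut: "cc_mask (m mod 2 - 2) = cut m" "cc_mask (m mod 2) = 1 - cut m"
  by (cases "even m"; auto elim!: evenE oddE simp: cc_mask_def)+

lemma subdiv_cc: "subdiv (\<lambda>_. cc_mask) g m = g (m div 2) + cut m * (g (m div 2 + 1) - g (m div 2))"
proof -
  have "subdiv (\<lambda>_. cc_mask) g m =
          cc_mask (m mod 2 - 2) * g (m div 2 + 1) + cc_mask (m mod 2) * g (m div 2)"
    by (rule subdiv_four_point) (simp add: cc_mask_def)
  then show ?thesis by (simp add: cc_mask_cut algebra_simps)
qed

lemma nucc_mask_cut:
  "nucc_mask k \<gamma> (m div 2) (m mod 2 - 2) = exp_quot (cut m) (\<gamma> m / 2 ^ k)"
  "nucc_mask k \<gamma> (m div 2) (m mod 2) = 1 - exp_quot (cut m) (\<gamma> m / 2 ^ k)"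
  by (cases "even m"; auto elim!: evenE oddE simp: nucc_mask_def)+

lemma subdiv_nucc:
  "subdiv (nucc_mask k \<gamma>) g m =
     g (m div 2) + exp_quot (cut m) (\<gamma> m / 2 ^ k) * (g (m div 2 + 1) - g (m div 2))"
proof -
  have "subdiv (nucc_mask k \<gamma>) g m =
          nucc_mask k \<gamma> (m div 2) (m mod 2 - 2) * g (m div 2 + 1)
          + nucc_mask k \<gamma> (m div 2) (m mod 2) * g (m div 2)"
    by (rule subdiv_four_point) (simp add: nucc_mask_def)
  then show ?thesis by (simp add: nucc_mask_cut algebra_simps)
qed

lemma grid_pt_child: "grid_pt (Suc k) m = grid_pt k (m div 2) + cut m / 2 ^ k"
proof -
  have "real_of_int m = 2 * of_int (m div 2) + of_int (m mod 2)"
    by (metis mult_div_mod_eq of_int_add of_int_mult of_int_numeral)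
  then show ?thesis by (simp add: grid_pt_def cut_def field_simps)
qed

lemma grid_pt_neighbour: "grid_pt k (j + 1) = grid_pt k j + 1 / 2 ^ k"
  by (simp add: grid_pt_def field_simps)

lemma grid_pt_child_bounds:
  "grid_pt k (m div 2) \<le> grid_pt (Suc k) m"
  "grid_pt (Suc k) m \<le> grid_pt k (m div 2 + 1)"
  using cut_range[of m] by (simp_all add: grid_pt_child grid_pt_neighbour divide_right_mono)

lemma convex_combination_bound:
  fixes a b \<theta> B :: real
  assumes "\<bar>a\<bar> \<le> B" "\<bar>b\<bar> \<le> B" "0 \<le> \<theta>" "\<theta> \<le> 1"
  shows "\<bar>a + \<theta> * (b - a)\<bar> \<le> B"
proof -
  have "a + \<theta> * (b - a) = (1 - \<theta>) * a + \<theta> * b" by (simp add: algebra_simps)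
  also have "\<bar>\<dots>\<bar> \<le> (1 - \<theta>) * \<bar>a\<bar> + \<theta> * \<bar>b\<bar>"
    using assms by (intro order_trans[OF abs_triangle_ineq]) (simp add: abs_mult)
  also have "\<dots> \<le> (1 - \<theta>) * B + \<theta> * B"
    using assms by (intro add_mono mult_left_mono) auto
  finally show ?thesis by (simp add: algebra_simps)
qed

section \<open>Smoothness of the sampled function\<close>

lemma sobolev_inf_AE_bounds:
  assumes "sobolev_inf r f"
  shows "\<exists>g M. g 0 = f \<and> M > 0 \<and>
           (\<forall>n<r. \<forall>a b. a \<le> b \<longrightarrow> (g (Suc n) has_integral (g n b - g n a)) {a..b}) \<and>
           (\<forall>n\<le>r. AE x in lebesgue. \<bar>g n x\<bar> \<le> M)"
proof -
  obtain g where g: "g 0 = f"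
     "\<And>n a b. n < r \<Longrightarrow> a \<le> b \<Longrightarrow> (g (Suc n) has_integral (g n b - g n a)) {a..b}"
     "(\<Sum>n\<le>r. esssup lebesgue (\<lambda>x. ereal \<bar>g n x\<bar>)) < \<infinity>"
    using assms unfolding sobolev_inf_def by auto
  have "esssup lebesgue (\<lambda>x. ereal \<bar>g n x\<bar>) \<noteq> \<infinity>" if "n \<le> r" for n
    using g(3) that sum_Pinfty[of "\<lambda>n. esssup lebesgue (\<lambda>x. ereal \<bar>g n x\<bar>)" "{..r}"] by auto
  then have "\<exists>B. esssup lebesgue (\<lambda>x. ereal \<bar>g n x\<bar>) \<le> ereal B" if "n \<le> r" for n
    using that by (metis ereal_cases ereal_less_eq(2) order_refl)
  then obtain B where B: "\<And>n. n \<le> r \<Longrightarrow> esssup lebesgue (\<lambda>x. ereal \<bar>g n x\<bar>) \<le> ereal (B n)"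
    by metis
  define M where "M = 1 + (\<Sum>n\<le>r. \<bar>B n\<bar>)"
  have "M > 0" unfolding M_def by (smt (verit) sum_nonneg abs_ge_zero)
  have "AE x in lebesgue. \<bar>g n x\<bar> \<le> M" if n: "n \<le> r" for n
  proof -
    have "\<bar>B n\<bar> \<le> (\<Sum>n\<le>r. \<bar>B n\<bar>)" using n by (intro member_le_sum) auto
    then have "B n \<le> M" unfolding M_def by linarith
    have "AE x in lebesgue. ereal \<bar>g n x\<bar> \<le> esssup lebesgue (\<lambda>x. ereal \<bar>g n x\<bar>)"
      by (rule esssup_AE)
    then show ?thesis
    proof eventually_elim
      case (elim x)
      then have "ereal \<bar>g n x\<bar> \<le> ereal (B n)" using B[OF n] by (rule order_trans)
      then show ?case using \<open>B n \<le> M\<close> by simp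
    qed
  qed
  then show ?thesis using g(1,2) \<open>M > 0\<close> by blast
qed

lemma has_integral_AE_bound:
  fixes g :: "real \<Rightarrow> real"
  assumes "(g has_integral I) {a..b}" "a \<le> b" "AE x in lebesgue. \<bar>g x\<bar> \<le> M" "M \<ge> 0"
  shows "\<bar>I\<bar> \<le> M * (b - a)"
proof -
  obtain N where N: "N \<in> null_sets lebesgue" "{x. \<not> \<bar>g x\<bar> \<le> M} \<subseteq> N"
    using assms(3) by (auto simp: eventually_ae_filter)
  have "negligible N" using N(1) by (simp add: negligible_iff_null_sets)
  then have "((\<lambda>x. if x \<in> N then 0 else g x) has_integral I) {a..b}"
    by (rule has_integral_spike[OF _ _ assms(1)]) auto
  then have "norm I \<le> M * measure lborel (cbox a b)"
    using assms(4) N(2) by (intro has_integral_bound) auto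
  then show ?thesis using assms(2) by simp
qed

lemma continuous_AE_bound:
  fixes g :: "real \<Rightarrow> real"
  assumes "continuous_on UNIV g" "AE x in lebesgue. \<bar>g x\<bar> \<le> M"
  shows "\<bar>g x\<bar> \<le> M"
proof -
  have "closed {x. \<bar>g x\<bar> \<le> M}"
    using assms(1) by (intro closed_Collect_le continuous_intros)
  then show ?thesis using mem_closed_if_AE_lebesgue[of "{x. \<bar>g x\<bar> \<le> M}" x] assms(2) by simp
qed

text \<open>
  The classical content of \<open>f \<in> W\<^sup>3\<^sub>\<infinity>\<close> used below. The third derivative, which exists only almost
  everywhere, enters as a Lipschitz condition on the second one.
\<close>

locale smooth_data =
  fixes f f1 f2 :: "real \<Rightarrow> real" and M :: real
  assumes M_pos: "M > 0"
    and deriv_f: "\<And>x. (f has_real_derivative f1 x) (at x)"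
    and deriv_f1: "\<And>x. (f1 has_real_derivative f2 x) (at x)"
    and f_bound: "\<And>x. \<bar>f x\<bar> \<le> M"
    and f2_bound: "\<And>x. \<bar>f2 x\<bar> \<le> M"
    and f2_lipschitz: "\<And>x y. \<bar>f2 x - f2 y\<bar> \<le> M * \<bar>x - y\<bar>"

text \<open>
  By the integral identity, the bound on each derivative makes the preceding one Lipschitz, hence
  continuous. Continuity turns the bounds that hold almost everywhere into pointwise ones and, by the
  fundamental theorem of calculus, the integral identity into differentiability.
\<close>

lemma sobolev_inf_3_smooth:
  assumes "sobolev_inf 3 f"
  obtains f1 f2 M where "smooth_data f f1 f2 M"
proof -
  obtain g M where g0: "g 0 = f" and M: "M > 0"
    and int: "\<And>n a b. n < 3 \<Longrightarrow> a \<le> b \<Longrightarrow> (g (Suc n) has_integral (g n b - g n a)) {a..b}"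
    and ae: "\<And>n. n \<le> 3 \<Longrightarrow> AE x in lebesgue. \<bar>g n x\<bar> \<le> M"
    using sobolev_inf_AE_bounds[OF assms] by blast
  have lip: "\<bar>g n x - g n y\<bar> \<le> M * \<bar>x - y\<bar>" if n: "n < 3" for n x y
  proof (induction x y rule: linorder_wlog)
    case (le x y)
    have "\<bar>g n y - g n x\<bar> \<le> M * (y - x)"
      using has_integral_AE_bound[OF int[OF n le] le ae] n M by auto
    then show ?case using le by (simp add: abs_minus_commute)
  next
    case (sym x y) then show ?case by (simp add: abs_minus_commute)
  qed
  have cont: "continuous_on UNIV (g n)" if "n < 3" for n
  proof -
    have "M-lipschitz_on UNIV (g n)"
      using lip[OF that] M by (intro lipschitz_onI) (auto simp: dist_real_def)
    then show ?thesis by (rule lipschitz_on_continuous_on)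
  qed
  have bound: "\<bar>g n x\<bar> \<le> M" if "n < 3" for n x
    using continuous_AE_bound[OF cont ae] that by simp
  have deriv: "(g n has_real_derivative g (Suc n) x) (at x)" if n: "Suc n < 3" for n x
  proof -
    have "((\<lambda>u. integral {x - 1..u} (g (Suc n))) has_real_derivative g (Suc n) x)
            (at x within {x - 1..x + 1})"
      using continuous_on_subset[OF cont[OF n]] by (intro integral_has_real_derivative) auto
    then have "((\<lambda>u. g n (x - 1) + integral {x - 1..u} (g (Suc n))) has_real_derivative g (Suc n) x)
            (at x within {x - 1..x + 1})"
      using DERIV_add[OF DERIV_const] by fastforce
    then have "(g n has_real_derivative g (Suc n) x) (at x within {x - 1..x + 1})"
      unfolding has_field_derivative_def
    proof (rule has_derivative_transform[rotated 2])
      fix u assume "u \<in> {x - 1..x + 1}"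
      then show "g n u = g n (x - 1) + integral {x - 1..u} (g (Suc n))"
        using integral_unique[OF int, of n "x - 1" u] n by auto
    qed auto
    moreover have "at x within {x - 1..x + 1} = at x"
      by (rule at_within_interior) simp
    ultimately show ?thesis by simp
  qed
  have "smooth_data f (g 1) (g 2) M"
    using M bound[of 0] bound[of 2] deriv[of 0] deriv[of 1] lip[of 2]
    by unfold_locales (simp_all add: g0 numeral_2_eq_2)
  then show thesis using that by blast
qed

context smooth_data
begin

lemma f1_lipschitz: "\<bar>f1 x - f1 y\<bar> \<le> M * \<bar>x - y\<bar>"
  using field_differentiable_bound[of UNIV f1 f2 M x y] deriv_f1 f2_bound by simp

lemma taylor_f1: "\<bar>f1 y - f1 c - f2 c * (y - c)\<bar> \<le> M * \<bar>y - c\<bar>\<^sup>2"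
proof -
  have "norm ((f1 y - f2 c * y) - (f1 c - f2 c * c)) \<le> M * \<bar>y - c\<bar> * norm (y - c)"
  proof (rule field_differentiable_bound[of "closed_segment c y" "\<lambda>z. f1 z - f2 c * z" "\<lambda>z. f2 z - f2 c"])
    fix z assume "z \<in> closed_segment c y"
    then have "\<bar>z - c\<bar> \<le> \<bar>y - c\<bar>" using segment_bound1[of z c y] by simp
    then have "M * \<bar>z - c\<bar> \<le> M * \<bar>y - c\<bar>" using M_pos by (intro mult_left_mono) auto
    then show "norm (f2 z - f2 c) \<le> M * \<bar>y - c\<bar>" using f2_lipschitz[of z c] by simp
  qed (auto intro!: derivative_eq_intros has_field_derivative_at_within[OF deriv_f1])
  then show ?thesis by (simp add: algebra_simps power2_eq_square)
qed

lemma taylor_f: "\<bar>f y - f c - f1 c * (y - c) - f2 c * (y - c)\<^sup>2 / 2\<bar> \<le> M * \<bar>y - c\<bar> ^ 3"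
proof -
  have "norm ((f y - f1 c * y - f2 c * (y - c)\<^sup>2 / 2) - (f c - f1 c * c - f2 c * (c - c)\<^sup>2 / 2))
          \<le> M * \<bar>y - c\<bar>\<^sup>2 * norm (y - c)"
  proof (rule field_differentiable_bound[of "closed_segment c y"
        "\<lambda>z. f z - f1 c * z - f2 c * (z - c)\<^sup>2 / 2" "\<lambda>z. f1 z - f1 c - f2 c * (z - c)"])
    fix z assume "z \<in> closed_segment c y"
    then have "\<bar>z - c\<bar> \<le> \<bar>y - c\<bar>" using segment_bound1[of z c y] by simp
    then have "M * \<bar>z - c\<bar>\<^sup>2 \<le> M * \<bar>y - c\<bar>\<^sup>2"
      using M_pos by (intro mult_left_mono power_mono) auto
    then show "norm (f1 z - f1 c - f2 c * (z - c)) \<le> M * \<bar>y - c\<bar>\<^sup>2" using taylor_f1[of z c] by simp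
  qed (auto intro!: derivative_eq_intros has_field_derivative_at_within[OF deriv_f])
  then show ?thesis by (simp add: algebra_simps power2_eq_square power3_eq_cube)
qed

text \<open>
  The reason for third order accuracy: on a quadratic, cutting a corner of an interval of length
  \<open>u\<close> errs by exactly \<open>\<theta> (1 - \<theta>) / 2\<close> times \<open>u\<^sup>2 f''\<close>. The second derivative may be taken at any point
  \<open>p\<close> of the interval; below, \<open>p\<close> is the parent at which the scheme takes its second difference.
\<close>

lemma corner_cut_error:
  assumes \<theta>: "0 \<le> \<theta>" "\<theta> \<le> 1" and u: "u \<ge> 0" and p: "a \<le> p" "p \<le> a + u"
  shows "\<bar>f a + \<theta> * (f (a + u) - f a) + \<theta> * (\<theta> - 1) / 2 * u\<^sup>2 * f2 p - f (a + \<theta> * u)\<bar> \<le> 2 * M * u ^ 3"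
proof -
  define c where "c = a + \<theta> * u"
  define R where "R y = f y - f c - f1 c * (y - c) - f2 c * (y - c)\<^sup>2 / 2" for y
  have \<theta>u: "0 \<le> \<theta> * u" "\<theta> * u \<le> u" using \<theta> u by (auto simp: mult_left_le_one_le)
  have "\<bar>R y\<bar> \<le> M * u ^ 3" if "\<bar>y - c\<bar> \<le> u" for y
  proof -
    have "M * \<bar>y - c\<bar> ^ 3 \<le> M * u ^ 3" using that M_pos by (intro mult_left_mono power_mono) auto
    then show ?thesis using taylor_f[of y c] unfolding R_def by linarith
  qed
  then have R: "\<bar>R a\<bar> \<le> M * u ^ 3" "\<bar>R (a + u)\<bar> \<le> M * u ^ 3"
    using \<theta>u by (auto simp: c_def)
  have R': "\<bar>R a + \<theta> * (R (a + u) - R a)\<bar> \<le> M * u ^ 3"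
    using R \<theta> by (rule convex_combination_bound)
  have "\<bar>p - c\<bar> \<le> u" using p \<theta>u by (auto simp: c_def)
  then have "M * \<bar>p - c\<bar> \<le> M * u" using M_pos by simp
  then have F: "\<bar>f2 p - f2 c\<bar> \<le> M * u" using f2_lipschitz[of p c] by linarith
  have "\<bar>\<theta> * (\<theta> - 1) / 2\<bar> \<le> 1"
    using \<theta> mult_mono[of \<theta> 1 "1 - \<theta>" 1] by (simp add: abs_mult)
  then have "\<bar>\<theta> * (\<theta> - 1) / 2\<bar> * u\<^sup>2 * \<bar>f2 p - f2 c\<bar> \<le> 1 * u\<^sup>2 * (M * u)"
    using F by (intro mult_mono) auto
  then have F': "\<bar>\<theta> * (\<theta> - 1) / 2 * u\<^sup>2 * (f2 p - f2 c)\<bar> \<le> M * u ^ 3"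
    by (simp add: abs_mult) (simp add: power2_eq_square power3_eq_cube algebra_simps)
  have "f a + \<theta> * (f (a + u) - f a) + \<theta> * (\<theta> - 1) / 2 * u\<^sup>2 * f2 p - f c
     = (R a + \<theta> * (R (a + u) - R a)) + \<theta> * (\<theta> - 1) / 2 * u\<^sup>2 * (f2 p - f2 c)"
    unfolding R_def c_def by (simp add: field_simps power2_eq_square)
  then show ?thesis using R' F' unfolding c_def[symmetric] by linarith
qed

end

section \<open>The increment with the alternative shape parameter\<close>

lemma abs_add_perturb:
  assumes "s \<in> {-1, 1}"
  shows "\<bar>x + perturb k0 s x\<bar> = \<bar>x\<bar> + (1 / 2 ^ k0)\<^sup>2"
    and "\<bar>perturb k0 s x\<bar> = (1 / 2 ^ k0)\<^sup>2"
proof -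
  define q :: real where "q = (1 / 2 ^ k0)\<^sup>2"
  have "q > 0" by (simp add: q_def)
  moreover have "perturb k0 s x = (if x = 0 then s else sgn x) * q"
    by (simp add: perturb_def q_def power_mult power_one_over divide_simps mult.commute[of 2])
  ultimately show "\<bar>x + perturb k0 s x\<bar> = \<bar>x\<bar> + (1 / 2 ^ k0)\<^sup>2"
    and "\<bar>perturb k0 s x\<bar> = (1 / 2 ^ k0)\<^sup>2"
    using assms unfolding q_def[symmetric] by (auto simp: sgn_if)
qed

text \<open>
  The bound is free of \<open>D\<close>: the perturbation has the sign of \<open>D\<close>, so a small \<open>D\<close> in the denominator of
  the shape parameter is compensated by the factor \<open>D\<close> of the increment. This is what allows the first
  differences to be controlled before anything is known about their size.
\<close>

lemma increment_deviation:
  assumes \<theta>: "0 \<le> \<theta>" "\<theta> \<le> 1" and s: "s \<in> {-1, 1}"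
  shows "\<bar>exp_quot \<theta> (d / (D + perturb k0 s D) / 2 ^ k) * D - \<theta> * D\<bar> \<le> 4 * \<bar>d\<bar> / 2 ^ k"
proof -
  define x where "x = d / (D + perturb k0 s D) / 2 ^ k"
  have pos: "\<bar>D + perturb k0 s D\<bar> > 0" "\<bar>D\<bar> \<le> \<bar>D + perturb k0 s D\<bar>"
    unfolding abs_add_perturb[OF s] by (simp_all add: add_nonneg_pos)
  have "\<bar>x\<bar> * \<bar>D\<bar> = \<bar>d\<bar> / 2 ^ k * (\<bar>D\<bar> / \<bar>D + perturb k0 s D\<bar>)"
    by (simp add: x_def abs_mult)
  also have "\<dots> \<le> \<bar>d\<bar> / 2 ^ k * 1"
    using pos by (intro mult_left_mono) auto
  finally have "\<bar>x\<bar> * \<bar>D\<bar> \<le> \<bar>d\<bar> / 2 ^ k" by simp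
  moreover have "\<bar>exp_quot \<theta> x - \<theta>\<bar> * \<bar>D\<bar> \<le> 4 * \<bar>x\<bar> * \<bar>D\<bar>"
    using exp_quot_deviation[OF \<theta>, of x] by (intro mult_right_mono) auto
  ultimately have "\<bar>(exp_quot \<theta> x - \<theta>) * D\<bar> \<le> 4 * \<bar>d\<bar> / 2 ^ k" unfolding abs_mult by simp
  then show ?thesis by (simp add: x_def left_diff_distrib)
qed

text \<open>
  Replacing \<open>D / (D + \<epsilon>)\<close> by \<open>1\<close> in the quadratic term costs \<open>\<bar>\<epsilon> / (D + \<epsilon>)\<bar>\<close>, hence the contribution with
  \<open>\<bar>\<epsilon>\<bar> = 4\<^sup>-\<^sup>k\<^sup>0\<close>; the other contribution is the remainder of the exponential quotient.
\<close>

lemma increment_expansion: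
  assumes \<theta>: "0 \<le> \<theta>" "\<theta> \<le> 1" and s: "s \<in> {-1, 1}" and D: "D \<noteq> 0"
  shows "\<bar>exp_quot \<theta> (d / (D + perturb k0 s D) / 2 ^ k) * D - \<theta> * D - \<theta> * (\<theta> - 1) / 2 * (d / 2 ^ k)\<bar>
           \<le> (\<bar>d\<bar> * (1 / 2 ^ k0)\<^sup>2 + 3 * d\<^sup>2) / (\<bar>D\<bar> * 2 ^ k)"
proof -
  define \<epsilon> where "\<epsilon> = perturb k0 s D"
  define x where "x = d / (D + \<epsilon>) / 2 ^ k"
  define \<beta> where "\<beta> = \<theta> * (\<theta> - 1) / 2"
  have \<beta>: "\<bar>\<beta>\<bar> \<le> 1"
    using \<theta> mult_mono[of \<theta> 1 "1 - \<theta>" 1] by (simp add: abs_mult \<beta>_def)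
  have pos: "\<bar>D + \<epsilon>\<bar> > 0" "\<bar>D\<bar> \<le> \<bar>D + \<epsilon>\<bar>"
    unfolding \<epsilon>_def abs_add_perturb[OF s] by (simp_all add: add_nonneg_pos)
  then have nz: "D + \<epsilon> \<noteq> 0" by auto
  have "x * (D + \<epsilon>) = d / 2 ^ k" using nz by (simp add: x_def)
  then have "x * D - d / 2 ^ k = - (x * \<epsilon>)" by (simp add: distrib_left)
  then have "\<bar>x * D - d / 2 ^ k\<bar> = \<bar>d\<bar> * (1 / 2 ^ k0)\<^sup>2 / (\<bar>D + \<epsilon>\<bar> * 2 ^ k)"
    using abs_add_perturb(2)[OF s, of k0 D] by (simp add: abs_mult \<epsilon>_def[symmetric] x_def)
  also have "\<dots> \<le> \<bar>d\<bar> * (1 / 2 ^ k0)\<^sup>2 / (\<bar>D\<bar> * 2 ^ k)"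
    using pos D by (intro divide_left_mono mult_right_mono) auto
  finally have lin: "\<bar>x * D - d / 2 ^ k\<bar> \<le> \<bar>d\<bar> * (1 / 2 ^ k0)\<^sup>2 / (\<bar>D\<bar> * 2 ^ k)" .
  have lin': "\<bar>\<beta> * (x * D - d / 2 ^ k)\<bar> \<le> \<bar>d\<bar> * (1 / 2 ^ k0)\<^sup>2 / (\<bar>D\<bar> * 2 ^ k)"
    unfolding abs_mult using mult_mono[OF \<beta> lin] by simp
  have "\<bar>x\<bar> = \<bar>d\<bar> / \<bar>D + \<epsilon>\<bar> / 2 ^ k" by (simp add: x_def abs_mult)
  also have "\<dots> \<le> \<bar>d\<bar> / \<bar>D\<bar> / 2 ^ k"
    using pos D by (intro divide_right_mono divide_left_mono) auto
  finally have "\<bar>x\<bar> \<le> \<bar>d\<bar> / \<bar>D\<bar> / 2 ^ k" .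
  then have "\<bar>x\<bar>\<^sup>2 \<le> (\<bar>d\<bar> / \<bar>D\<bar> / 2 ^ k)\<^sup>2" by (intro power_mono) auto
  then have "x\<^sup>2 * \<bar>D\<bar> \<le> (\<bar>d\<bar> / \<bar>D\<bar> / 2 ^ k)\<^sup>2 * \<bar>D\<bar>" by (intro mult_right_mono) auto
  also have "\<dots> = d\<^sup>2 / (\<bar>D\<bar> * 2 ^ k) / 2 ^ k"
    using D by (simp add: power2_eq_square field_simps)
  also have "\<dots> \<le> d\<^sup>2 / (\<bar>D\<bar> * 2 ^ k) / 1"
    using D by (intro divide_left_mono) auto
  finally have quad: "x\<^sup>2 * \<bar>D\<bar> \<le> d\<^sup>2 / (\<bar>D\<bar> * 2 ^ k)" by simp
  have "\<bar>exp_quot \<theta> x - \<theta> - \<beta> * x\<bar> * \<bar>D\<bar> \<le> 3 * x\<^sup>2 * \<bar>D\<bar>"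
    using exp_quot_expansion[OF \<theta>, of x] unfolding \<beta>_def by (intro mult_right_mono) auto
  then have quad': "\<bar>(exp_quot \<theta> x - \<theta> - \<beta> * x) * D\<bar> \<le> 3 * d\<^sup>2 / (\<bar>D\<bar> * 2 ^ k)"
    unfolding abs_mult using quad by simp
  have "exp_quot \<theta> x * D - \<theta> * D - \<beta> * (d / 2 ^ k)
          = (exp_quot \<theta> x - \<theta> - \<beta> * x) * D + \<beta> * (x * D - d / 2 ^ k)"
    by (simp add: algebra_simps)
  also have "\<bar>\<dots>\<bar> \<le> \<bar>d\<bar> * (1 / 2 ^ k0)\<^sup>2 / (\<bar>D\<bar> * 2 ^ k) + 3 * d\<^sup>2 / (\<bar>D\<bar> * 2 ^ k)"
    using lin' quad' by linarith
  finally show ?thesis by (simp add: x_def \<epsilon>_def \<beta>_def add_divide_distrib)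
qed

text \<open>
  A radius of \<open>2 \<cdot> 2\<^sup>-\<^sup>k\<close> makes the windows contain the parents of their points: a parent at level \<open>k\<close> is
  at most \<open>2\<^sup>-\<^sup>k\<close> away from its child, which is itself within \<open>2 \<cdot> 2\<^sup>-\<^sup>k\<^sup>-\<^sup>1 = 2\<^sup>-\<^sup>k\<close> of the centre.
\<close>

definition window :: "real \<Rightarrow> nat \<Rightarrow> int \<Rightarrow> bool" where
  "window t k j \<longleftrightarrow> \<bar>grid_pt k j - t\<bar> \<le> 2 / 2 ^ k"

lemma window_parents:
  assumes "window t (Suc k) m"
  shows "window t k (m div 2)" "window t k (m div 2 + 1)"
proof -
  have "\<bar>grid_pt (Suc k) m - t\<bar> \<le> 1 / 2 ^ k" using assms by (simp add: window_def)
  moreover have "2 / 2 ^ k = 1 / 2 ^ k + 1 / (2 ^ k :: real)" by simp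
  ultimately show "window t k (m div 2)" "window t k (m div 2 + 1)"
    using grid_pt_child_bounds[of k m] grid_pt_neighbour[of k "m div 2"]
    unfolding window_def by linarith+
qed

section \<open>Second differences, first differences and the error of the scheme\<close>

locale nucc_scheme = smooth_data +
  fixes k0 :: nat and \<sigma> :: "nat \<Rightarrow> int \<Rightarrow> real"
  assumes sign: "\<And>k m. \<sigma> k m \<in> {-1, 1}"
begin

definition h :: real where "h = 1 / 2 ^ k0"
definition F0 :: "int \<Rightarrow> real" where "F0 n = f ((real_of_int n - 1/2) / 2 ^ k0)"
definition F :: "nat \<Rightarrow> int \<Rightarrow> real" where "F = nucc_data k0 \<sigma> F0"
definition d :: "nat \<Rightarrow> int \<Rightarrow> real" where "d = cc_data (second_diff F0)"

abbreviation D :: "nat \<Rightarrow> int \<Rightarrow> real" where "D k m \<equiv> scaled_diff k (F k) m"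

lemma h_range: "0 < h" "h \<le> 1" by (simp_all add: h_def)

lemma F0_eq: "F0 j = f (h * grid_pt 0 j)"
  by (simp add: F0_def h_def grid_pt_def)

lemma F_0: "F 0 j = f (h * grid_pt 0 j)"
  by (simp add: F_def F0_eq)

lemma D_eq: "F k (j + 1) - F k j = D k (j + 1) / 2 ^ k"
  by (simp add: scaled_diff_def)

text \<open>
  The weight of the right parent in the scheme, that is \<open>a\<^sub>-\<^sub>2\<close> for even and \<open>a\<^sub>-\<^sub>1\<close> for odd \<open>m\<close>.
\<close>

definition weight :: "nat \<Rightarrow> int \<Rightarrow> real" where
  "weight k m = exp_quot (cut m)
     (d k (m div 2 + m mod 2)
       / (D k (m div 2 + 1) + perturb k0 (\<sigma> k m) (D k (m div 2 + 1))) / 2 ^ k)"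

lemma F_Suc: "F (Suc k) m = F k (m div 2) + weight k m * (F k (m div 2 + 1) - F k (m div 2))"
  by (simp add: F_def weight_def subdiv_nucc alt_shape_def d_def Let_def)

lemma d_Suc: "d (Suc k) m = d k (m div 2) + cut m * (d k (m div 2 + 1) - d k (m div 2))"
  by (simp add: d_def cc_data_def subdiv_cc)

lemma F_bound: "\<bar>F k j\<bar> \<le> M"
proof (induction k arbitrary: j)
  case 0 show ?case by (simp add: F_0 f_bound)
next
  case (Suc k)
  show ?case unfolding F_Suc weight_def
    by (intro convex_combination_bound Suc exp_quot_in_unit cut_range)
qed

lemma d_approx_0: "\<bar>d 0 j - h\<^sup>2 * f2 (h * grid_pt 0 j)\<bar> \<le> 2 * M * h ^ 3"
proof -
  define c where "c = h * grid_pt 0 j"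
  define R where "R y = f y - f c - f1 c * (y - c) - f2 c * (y - c)\<^sup>2 / 2" for y
  have R: "\<bar>R y\<bar> \<le> M * \<bar>y - c\<bar> ^ 3" for y unfolding R_def by (rule taylor_f)
  have "d 0 j = f (c - h) - 2 * f c + f (c + h)"
    by (simp add: d_def cc_data_def second_diff_def F0_eq c_def grid_pt_def algebra_simps)
  then have "d 0 j - h\<^sup>2 * f2 c = R (c - h) + R (c + h)"
    by (simp add: R_def)
  then show ?thesis using R[of "c - h"] R[of "c + h"] h_range unfolding c_def[symmetric] by simp
qed

text \<open>
  Corner cutting preserves the initial error of \<open>h\<^sup>2 f''\<close>, and going from level \<open>k\<close> to the next moves the point of
  evaluation by at most \<open>h 2\<^sup>-\<^sup>k\<close>. These moves add up to at most \<open>2 h\<close>.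
\<close>

lemma d_approx: "\<bar>d k j - h\<^sup>2 * f2 (h * grid_pt k j)\<bar> \<le> (4 - 2 / 2 ^ k) * M * h ^ 3"
proof (induction k arbitrary: j)
  case 0 then show ?case using d_approx_0[of j] by simp
next
  case (Suc k)
  define i where "i = j div 2"
  define p where "p = h * grid_pt (Suc k) j"
  define B where "B = (4 - 1 / 2 ^ k) * M * h ^ 3"
  have near: "\<bar>d k l - h\<^sup>2 * f2 p\<bar> \<le> B" if "\<bar>grid_pt k l - grid_pt (Suc k) j\<bar> \<le> 1 / 2 ^ k" for l
  proof -
    have "\<bar>h * grid_pt k l - p\<bar> = h * \<bar>grid_pt k l - grid_pt (Suc k) j\<bar>"
      unfolding p_def right_diff_distrib[symmetric] abs_mult using h_range by simp
    also have "\<dots> \<le> h * (1 / 2 ^ k)" using that h_range by (intro mult_left_mono) auto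
    finally have "M * \<bar>h * grid_pt k l - p\<bar> \<le> M * (h * (1 / 2 ^ k))"
      using M_pos by (intro mult_left_mono) auto
    then have "\<bar>f2 (h * grid_pt k l) - f2 p\<bar> \<le> M * (h * (1 / 2 ^ k))"
      using f2_lipschitz by (rule order_trans[rotated])
    then have "h\<^sup>2 * \<bar>f2 (h * grid_pt k l) - f2 p\<bar> \<le> h\<^sup>2 * (M * (h * (1 / 2 ^ k)))"
      by (intro mult_left_mono) auto
    then have "\<bar>h\<^sup>2 * f2 (h * grid_pt k l) - h\<^sup>2 * f2 p\<bar> \<le> 1 / 2 ^ k * M * h ^ 3"
      unfolding right_diff_distrib[symmetric] abs_mult
      by (simp add: power2_eq_square power3_eq_cube mult_ac)
    moreover have "(4 - 2 / 2 ^ k) * M * h ^ 3 + 1 / 2 ^ k * M * h ^ 3 = B"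
      by (simp add: B_def field_simps)
    ultimately show ?thesis using Suc[of l] by linarith
  qed
  have "\<bar>(d k i - h\<^sup>2 * f2 p) + cut j * ((d k (i + 1) - h\<^sup>2 * f2 p) - (d k i - h\<^sup>2 * f2 p))\<bar> \<le> B"
    using grid_pt_child_bounds[of k j] grid_pt_neighbour[of k "j div 2"] unfolding i_def
    by (intro convex_combination_bound near cut_range) auto
  moreover have "d (Suc k) j - h\<^sup>2 * f2 p
      = (d k i - h\<^sup>2 * f2 p) + cut j * ((d k (i + 1) - h\<^sup>2 * f2 p) - (d k i - h\<^sup>2 * f2 p))"
    by (simp add: d_Suc i_def)
  ultimately show ?case unfolding p_def[symmetric] by (simp add: B_def)
qed

lemma d_bound: "\<bar>d k j\<bar> \<le> 5 * M * h\<^sup>2"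
proof -
  have "(4 - 2 / 2 ^ k) * M * h ^ 3 \<le> 4 * M * h\<^sup>2"
    using h_range M_pos power_decreasing[of 2 3 h] by (intro mult_mono) auto
  moreover have "\<bar>h\<^sup>2 * f2 (h * grid_pt k j)\<bar> \<le> M * h\<^sup>2"
    using f2_bound by (simp add: abs_mult mult_right_mono mult.commute[of "h\<^sup>2"])
  ultimately show ?thesis using d_approx[of k j] by (simp add: abs_le_iff)
qed

lemma weight_deviation: "\<bar>weight k m * D k (m div 2 + 1) - cut m * D k (m div 2 + 1)\<bar> \<le> 20 * M * h\<^sup>2 / 2 ^ k"
proof -
  have "\<bar>weight k m * D k (m div 2 + 1) - cut m * D k (m div 2 + 1)\<bar> \<le> 4 * \<bar>d k (m div 2 + m mod 2)\<bar> / 2 ^ k"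
    unfolding weight_def by (intro increment_deviation cut_range sign)
  also have "\<dots> \<le> 4 * (5 * M * h\<^sup>2) / 2 ^ k"
    using d_bound by (intro divide_right_mono mult_left_mono) auto
  finally show ?thesis by simp
qed

text \<open>
  A new difference is, up to the deviation of the weights, either \<open>D\<close> itself or the mean of two neighbouring
  ones. Two weights, the scaling by \<open>2\<close> and the bound of \<open>weight_deviation\<close> give a loss of
  \<open>80 M h\<^sup>2 2\<^sup>-\<^sup>k\<close> per level, and \<open>160 M h\<^sup>2\<close> in total.
\<close>

lemma D_lower_bound:
  assumes D0: "\<And>j. window t 0 j \<Longrightarrow> window t 0 (j + 1) \<Longrightarrow> s * D 0 (j + 1) \<ge> \<delta>"
    and s: "\<bar>s\<bar> = 1"
    and win: "window t k j" "window t k (j + 1)"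
  shows "s * D k (j + 1) \<ge> \<delta> - 160 * M * h\<^sup>2 * (1 - 1 / 2 ^ k)"
  using win
proof (induction k arbitrary: j)
  case 0 then show ?case using D0 by simp
next
  case (Suc k)
  define \<eta> where "\<eta> = 20 * M * h\<^sup>2 / 2 ^ k"
  define A where "A = \<delta> - 160 * M * h\<^sup>2 * (1 - 1 / 2 ^ k)"
  have target: "\<delta> - 160 * M * h\<^sup>2 * (1 - 1 / 2 ^ Suc k) = A - 4 * \<eta>"
    by (simp add: A_def \<eta>_def field_simps)
  have dev: "\<bar>s * (weight k m * D k (m div 2 + 1)) - cut m * (s * D k (m div 2 + 1))\<bar> \<le> \<eta>" for m
  proof -
    have "s * (weight k m * D k (m div 2 + 1)) - cut m * (s * D k (m div 2 + 1))
        = s * (weight k m * D k (m div 2 + 1) - cut m * D k (m div 2 + 1))" by (simp add: algebra_simps)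
    then show ?thesis using weight_deviation[of k m] s by (simp add: abs_mult \<eta>_def)
  qed
  show ?case
  proof (cases "even j")
    case True
    then obtain i where j: "j = 2 * i" by (elim evenE)
    have low: "s * D k (i + 1) \<ge> A"
      using Suc.IH[of i] window_parents[OF Suc.prems(1)] by (simp add: j A_def)
    have "D (Suc k) (j + 1) = 2 * (weight k (2 * i + 1) * D k (i + 1) - weight k (2 * i) * D k (i + 1))"
    proof -
      have "F (Suc k) (2 * i + 1) = F k i + weight k (2 * i + 1) * (D k (i + 1) / 2 ^ k)"
        "F (Suc k) (2 * i) = F k i + weight k (2 * i) * (D k (i + 1) / 2 ^ k)"
        unfolding F_Suc by (simp_all add: D_eq)
      then show ?thesis by (simp add: scaled_diff_def[of "Suc k"] j field_simps)
    qed
    then have "s * D (Suc k) (j + 1)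
        = 2 * (s * (weight k (2 * i + 1) * D k (i + 1))) - 2 * (s * (weight k (2 * i) * D k (i + 1)))"
      by (simp only:) (simp add: algebra_simps)
    moreover have "\<bar>s * (weight k (2 * i) * D k (i + 1)) - 1 / 4 * (s * D k (i + 1))\<bar> \<le> \<eta>"
      "\<bar>s * (weight k (2 * i + 1) * D k (i + 1)) - 3 / 4 * (s * D k (i + 1))\<bar> \<le> \<eta>"
      using dev[of "2 * i"] dev[of "2 * i + 1"] by simp_all
    ultimately show ?thesis using low unfolding target by linarith
  next
    case False
    then obtain i where j: "j = 2 * i + 1" by (elim oddE)
    have j1: "j + 1 = 2 * (i + 1)" by (simp add: j)
    have low: "s * D k (i + 1) \<ge> A" "s * D k (i + 1 + 1) \<ge> A"
      using Suc.IH[of i] Suc.IH[of "i + 1"] window_parents[OF Suc.prems(1)] window_parents[OF Suc.prems(2)]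
      unfolding j1 by (simp_all add: j A_def)
    have "D (Suc k) (j + 1) = 2 * (D k (i + 1) - weight k (2 * i + 1) * D k (i + 1)
        + weight k (2 * (i + 1)) * D k (i + 1 + 1))"
    proof -
      have "F (Suc k) (j + 1) = F k (i + 1) + weight k (2 * (i + 1)) * (D k (i + 1 + 1) / 2 ^ k)"
      proof -
        have "2 * (i + 1) div 2 = i + 1" by simp
        then show ?thesis unfolding j1 F_Suc by (simp only: D_eq)
      qed
      moreover have "F (Suc k) j = F k (i + 1) - D k (i + 1) / 2 ^ k + weight k (2 * i + 1) * (D k (i + 1) / 2 ^ k)"
        unfolding j F_Suc by (simp add: D_eq[symmetric])
      ultimately show ?thesis
        by (simp add: scaled_diff_def[of "Suc k"] field_simps)
    qed
    then have "s * D (Suc k) (j + 1) = 2 * (s * D k (i + 1))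
        - 2 * (s * (weight k (2 * i + 1) * D k (i + 1))) + 2 * (s * (weight k (2 * (i + 1)) * D k (i + 1 + 1)))"
      by (simp only:) (simp add: algebra_simps)
    moreover have
      "\<bar>s * (weight k (2 * (i + 1)) * D k (i + 1 + 1)) - 1 / 4 * (s * D k (i + 1 + 1))\<bar> \<le> \<eta>"
      "\<bar>s * (weight k (2 * i + 1) * D k (i + 1)) - 3 / 4 * (s * D k (i + 1))\<bar> \<le> \<eta>"
      using dev[of "2 * (i + 1)"] dev[of "2 * i + 1"] unfolding cut_even cut_odd by simp_all
    ultimately show ?thesis using low unfolding target by linarith
  qed
qed

text \<open>
  The error at a child consists of the interpolated error of the parents and three local
  contributions, all of order \<open>4\<^sup>-\<^sup>k h\<^sup>3\<close>: the remainder of the mask expansion, the inaccuracy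
  of \<open>d\<^sup>k\<close> as an approximation of \<open>h\<^sup>2 f''\<close>, and the Taylor error of corner cutting. They supply the summands
  of the constant in this order: \<open>(5 M + 75 M\<^sup>2) / c\<close>, \<open>4 M\<close> and \<open>2 M\<close>.
\<close>

lemma F_step_error:
  assumes D: "\<bar>D k (m div 2 + 1)\<bar> \<ge> c * h" and c: "c > 0"
    and B: "\<bar>F k (m div 2) - f (h * grid_pt k (m div 2))\<bar> \<le> B"
      "\<bar>F k (m div 2 + 1) - f (h * grid_pt k (m div 2 + 1))\<bar> \<le> B"
  shows "\<bar>F (Suc k) m - f (h * grid_pt (Suc k) m)\<bar>
          \<le> B + (6 * M + (5 * M + 75 * M\<^sup>2) / c) * h ^ 3 / 4 ^ k"
proof -
  define a where "a = h * grid_pt k (m div 2)"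
  define u where "u = h / 2 ^ k"
  define q where "q = m div 2 + m mod 2"
  define p where "p = h * grid_pt k q"
  define \<Delta> where "\<Delta> = D k (m div 2 + 1)"
  define \<beta> where "\<beta> = cut m * (cut m - 1) / 2"
  define e where "e = F k (m div 2) - f a"
  define e' where "e' = F k (m div 2 + 1) - f (a + u)"
  have pow4: "(4::real) ^ k = 2 ^ k * 2 ^ k" by (simp add: power_mult_distrib[symmetric])
  have right: "h * grid_pt k (m div 2 + 1) = a + u"
    unfolding grid_pt_neighbour by (simp add: a_def u_def distrib_left)
  have child: "h * grid_pt (Suc k) m = a + cut m * u"
    by (simp add: grid_pt_child a_def u_def algebra_simps)
  have u: "0 \<le> u" "u \<le> h" using h_range by (simp_all add: u_def divide_le_eq)
  have \<beta>: "\<bar>\<beta>\<bar> \<le> 1" unfolding \<beta>_def cut_correction by simp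
  have p: "a \<le> p" "p \<le> a + u"
    using u right by (cases "even m"; auto simp: p_def q_def a_def odd_iff_mod_2_eq_one even_iff_mod_2_eq_zero)+
  have ch: "c * h > 0" using c h_range by simp
  have \<Delta>: "\<bar>\<Delta>\<bar> \<ge> c * h" "\<Delta> \<noteq> 0" using D ch by (auto simp: \<Delta>_def)

  have mask: "\<bar>weight k m * \<Delta> - cut m * \<Delta> - \<beta> * (d k q / 2 ^ k)\<bar> \<le> (5 * M + 75 * M\<^sup>2) / c * h ^ 3 / 2 ^ k"
  proof -
    have "\<bar>weight k m * \<Delta> - cut m * \<Delta> - \<beta> * (d k q / 2 ^ k)\<bar>
        \<le> (\<bar>d k q\<bar> * (1 / 2 ^ k0)\<^sup>2 + 3 * (d k q)\<^sup>2) / (\<bar>\<Delta>\<bar> * 2 ^ k)"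
      unfolding weight_def \<beta>_def \<Delta>_def[symmetric] q_def[symmetric]
      by (intro increment_expansion cut_range sign \<Delta>)
    also have "\<dots> \<le> (5 * M * h\<^sup>2 * h\<^sup>2 + 3 * (5 * M * h\<^sup>2)\<^sup>2) / (c * h * 2 ^ k)"
    proof (intro frac_le add_mono mult_mono)
      have "\<bar>d k q\<bar>\<^sup>2 \<le> (5 * M * h\<^sup>2)\<^sup>2" using d_bound by (intro power_mono) auto
      then show "(d k q)\<^sup>2 \<le> (5 * M * h\<^sup>2)\<^sup>2" by simp
    qed (use d_bound \<Delta> ch M_pos in \<open>auto simp: h_def[symmetric]\<close>)
    also have "\<dots> = (5 * M + 75 * M\<^sup>2) / c * h ^ 3 / 2 ^ k"
      using c h_range by (simp add: field_simps power2_eq_square power3_eq_cube)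
    finally show ?thesis .
  qed
  have "\<bar>(weight k m * \<Delta> - cut m * \<Delta> - \<beta> * (d k q / 2 ^ k)) / 2 ^ k\<bar>
      \<le> (5 * M + 75 * M\<^sup>2) / c * h ^ 3 / 2 ^ k / 2 ^ k"
    unfolding abs_divide using mask by (simp only: power_abs abs_numeral) (rule divide_right_mono, auto)
  moreover have "(weight k m - cut m) * (\<Delta> / 2 ^ k) - \<beta> * d k q / 4 ^ k
      = (weight k m * \<Delta> - cut m * \<Delta> - \<beta> * (d k q / 2 ^ k)) / 2 ^ k"
    by (simp add: pow4 left_diff_distrib diff_divide_distrib)
  ultimately have mask': "\<bar>(weight k m - cut m) * (\<Delta> / 2 ^ k) - \<beta> * d k q / 4 ^ k\<bar>
      \<le> (5 * M + 75 * M\<^sup>2) / c * h ^ 3 / 4 ^ k"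
    by (simp only: pow4 divide_divide_eq_left)

  have "\<bar>d k q - h\<^sup>2 * f2 p\<bar> \<le> 4 * M * h ^ 3"
  proof -
    have "(4 - 2 / 2 ^ k) * M * h ^ 3 \<le> 4 * M * h ^ 3"
      using h_range M_pos by (intro mult_right_mono) auto
    then show ?thesis using d_approx[of k q] unfolding p_def by linarith
  qed
  then have "\<bar>\<beta>\<bar> * \<bar>d k q - h\<^sup>2 * f2 p\<bar> \<le> 1 * (4 * M * h ^ 3)"
    using \<beta> by (intro mult_mono) auto
  then have "\<bar>\<beta> * (d k q - h\<^sup>2 * f2 p)\<bar> / 4 ^ k \<le> 4 * M * h ^ 3 / 4 ^ k"
    by (intro divide_right_mono) (auto simp: abs_mult)
  then have curvature: "\<bar>\<beta> * (d k q - h\<^sup>2 * f2 p) / 4 ^ k\<bar> \<le> 4 * M * h ^ 3 / 4 ^ k" by simp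

  have "2 * M * u ^ 3 = 2 * M * h ^ 3 / (4 ^ k * 2 ^ k)"
    by (simp add: u_def pow4 power3_eq_cube)
  also have "\<dots> \<le> 2 * M * h ^ 3 / (4 ^ k * 1)"
    using M_pos h_range by (intro divide_left_mono mult_left_mono) auto
  finally have taylor: "\<bar>f a + cut m * (f (a + u) - f a) + \<beta> * u\<^sup>2 * f2 p - f (a + cut m * u)\<bar>
      \<le> 2 * M * h ^ 3 / 4 ^ k"
    using corner_cut_error[OF cut_range[of m] u(1) p] by (simp add: \<beta>_def)

  have inherited: "\<bar>e + cut m * (e' - e)\<bar> \<le> B"
    using B cut_range unfolding e_def e'_def right a_def[symmetric] by (rule convex_combination_bound)
  have split: "F (Suc k) m - f (h * grid_pt (Suc k) m)
     = (e + cut m * (e' - e)) + ((weight k m - cut m) * (\<Delta> / 2 ^ k) - \<beta> * d k q / 4 ^ k)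
       + \<beta> * (d k q - h\<^sup>2 * f2 p) / 4 ^ k
       + (f a + cut m * (f (a + u) - f a) + \<beta> * u\<^sup>2 * f2 p - f (a + cut m * u))"
  proof -
    have "\<Delta> / 2 ^ k = F k (m div 2 + 1) - F k (m div 2)" by (simp add: D_eq \<Delta>_def)
    moreover have "u\<^sup>2 = h\<^sup>2 / 4 ^ k" by (simp add: u_def pow4 power2_eq_square)
    ultimately show ?thesis unfolding F_Suc child e_def e'_def
      by (simp only:) (simp add: algebra_simps diff_divide_distrib)
  qed
  have "\<bar>F (Suc k) m - f (h * grid_pt (Suc k) m)\<bar>
      \<le> B + (5 * M + 75 * M\<^sup>2) / c * h ^ 3 / 4 ^ k + 4 * M * h ^ 3 / 4 ^ k + 2 * M * h ^ 3 / 4 ^ k"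
    unfolding split
    by (rule order_trans[OF abs_triangle_ineq add_mono[OF order_trans[OF abs_triangle_ineq
          add_mono[OF order_trans[OF abs_triangle_ineq add_mono[OF inherited mask']] curvature]] taylor]])
  also have "\<dots> = B + (6 * M + (5 * M + 75 * M\<^sup>2) / c) * h ^ 3 / 4 ^ k"
    by (simp add: distrib_right add_divide_distrib)
  finally show ?thesis .
qed

lemma F_error:
  assumes D: "\<And>k j. window t k j \<Longrightarrow> window t k (j + 1) \<Longrightarrow> \<bar>D k (j + 1)\<bar> \<ge> c * h"
    and c: "c > 0" and "window t k j"
  defines "K \<equiv> 6 * M + (5 * M + 75 * M\<^sup>2) / c"
  shows "\<bar>F k j - f (h * grid_pt k j)\<bar> \<le> 2 * K * h ^ 3 * (1 - 1 / 4 ^ k)"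
  using assms(3)
proof (induction k arbitrary: j)
  case 0 show ?case by (simp add: F_0)
next
  case (Suc k)
  note win = window_parents[OF Suc.prems]
  have "K > 0" using M_pos c unfolding K_def by (intro add_pos_pos divide_pos_pos) auto
  have "\<bar>F (Suc k) j - f (h * grid_pt (Suc k) j)\<bar>
      \<le> 2 * K * h ^ 3 * (1 - 1 / 4 ^ k) + K * h ^ 3 / 4 ^ k"
    unfolding K_def by (rule F_step_error[OF D[OF win] c Suc.IH[OF win(1), unfolded K_def]
          Suc.IH[OF win(2), unfolded K_def]])
  also have "\<dots> = 2 * K * h ^ 3 * (1 - 1 / 4 ^ Suc k) - K * h ^ 3 / 4 ^ k / 2"
    by (simp add: field_simps)
  also have "\<dots> \<le> 2 * K * h ^ 3 * (1 - 1 / 4 ^ Suc k)"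
    using \<open>K > 0\<close> h_range by simp
  finally show ?case .
qed

text \<open>
  The initial difference is \<open>h f'\<close> at a point within \<open>2 h\<close> of the centre, where \<open>f'\<close> differs from its central
  value by at most \<open>2 M h \<le> \<tau> / 2\<close>.
\<close>

lemma D_0_lower_bound:
  assumes \<tau>: "\<bar>f1 (h * t)\<bar> \<ge> \<tau>" "h \<le> \<tau> / (4 * M)"
    and win: "window t 0 j" "window t 0 (j + 1)"
  shows "sgn (f1 (h * t)) * D 0 (j + 1) \<ge> \<tau> / 2 * h"
proof -
  define x where "x = h * grid_pt 0 j"
  define s where "s = sgn (f1 (h * t))"
  have "x < x + h" using h_range by simp
  then obtain z where z: "x < z" "z < x + h" "f (x + h) - f x = (x + h - x) * f1 z"
    using MVT2[of x "x + h" f f1] deriv_f by blast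
  have "D 0 (j + 1) = h * f1 z"
    using z(3) by (simp add: scaled_diff_def F_0 grid_pt_neighbour x_def distrib_left)
  have "\<bar>x - h * t\<bar> \<le> h * 2" "\<bar>x + h - h * t\<bar> \<le> h * 2"
  proof -
    have "\<bar>x - h * t\<bar> = h * \<bar>grid_pt 0 j - t\<bar>" "\<bar>x + h - h * t\<bar> = h * \<bar>grid_pt 0 (j + 1) - t\<bar>"
      using h_range unfolding grid_pt_neighbour
      by (simp_all add: x_def abs_mult_pos' algebra_simps)
    then show "\<bar>x - h * t\<bar> \<le> h * 2" "\<bar>x + h - h * t\<bar> \<le> h * 2"
      using win h_range by (auto simp: window_def)
  qed
  then have "\<bar>z - h * t\<bar> \<le> h * 2" using z by linarith
  then have "M * \<bar>z - h * t\<bar> \<le> M * (h * 2)" using M_pos by (intro mult_left_mono) auto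
  also have "\<dots> \<le> \<tau> / 2" using \<tau>(2) M_pos by (simp add: field_simps)
  finally have "\<bar>f1 z - f1 (h * t)\<bar> \<le> \<tau> / 2" using f1_lipschitz[of z "h * t"] by linarith
  then have "s * f1 z \<ge> \<tau> / 2"
    using \<tau> M_pos h_range unfolding s_def by (auto simp: sgn_if abs_if field_simps split: if_splits)
  then have "h * (s * f1 z) \<ge> h * (\<tau> / 2)" using h_range by (intro mult_left_mono) auto
  then show ?thesis unfolding \<open>D 0 (j + 1) = h * f1 z\<close> s_def by (simp add: mult_ac)
qed

text \<open>
  The threshold on \<open>h\<close> is chosen such that the total loss \<open>160 M h\<^sup>2\<close> of the differences is at most half of their
  initial size \<open>\<tau> h / 2\<close>.
\<close>

lemma F_third_order:
  assumes "\<tau> > 0" "\<bar>f1 (h * t)\<bar> \<ge> \<tau>" "h \<le> \<tau> / (640 * M)" "window t k j"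
  shows "\<bar>F k j - f (h * grid_pt k j)\<bar> \<le> 2 * (6 * M + (5 * M + 75 * M\<^sup>2) / (\<tau> / 4)) * h ^ 3"
proof -
  have "\<tau> / (640 * M) \<le> \<tau> / (4 * M)"
    using assms(1) M_pos by (intro divide_left_mono) auto
  then have small: "h \<le> \<tau> / (4 * M)" using assms(3) by linarith
  have loss: "160 * M * h\<^sup>2 \<le> \<tau> / 4 * h"
    using assms(3) M_pos h_range by (simp add: field_simps power2_eq_square)
  have D: "\<bar>D k (j + 1)\<bar> \<ge> \<tau> / 4 * h" if "window t k j" "window t k (j + 1)" for k j
  proof -
    define s where "s = sgn (f1 (h * t))"
    have s: "\<bar>s\<bar> = 1" using assms(1,2) by (auto simp: s_def abs_sgn_eq)
    have "s * D k (j + 1) \<ge> \<tau> / 2 * h - 160 * M * h\<^sup>2 * (1 - 1 / 2 ^ k)"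
      unfolding s_def
      using D_lower_bound[OF D_0_lower_bound[OF assms(2) small] _ that] s unfolding s_def by blast
    moreover have "160 * M * h\<^sup>2 * (1 - 1 / 2 ^ k) \<le> 160 * M * h\<^sup>2 * 1"
      using M_pos by (intro mult_left_mono) auto
    moreover have "s * D k (j + 1) \<le> \<bar>D k (j + 1)\<bar>"
      using s abs_ge_self[of "s * D k (j + 1)"] by (simp add: abs_mult)
    ultimately show ?thesis using loss by linarith
  qed
  define K where "K = 6 * M + (5 * M + 75 * M\<^sup>2) / (\<tau> / 4)"
  have "K > 0" using M_pos assms(1) unfolding K_def by (intro add_pos_pos divide_pos_pos) auto
  have "\<bar>F k j - f (h * grid_pt k j)\<bar> \<le> 2 * K * h ^ 3 * (1 - 1 / 4 ^ k)"
    unfolding K_def using F_error[OF D _ assms(4)] assms(1) by simp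
  also have "\<dots> \<le> 2 * K * h ^ 3 * 1"
    using \<open>K > 0\<close> h_range by (intro mult_left_mono) auto
  finally show ?thesis by (simp add: K_def)
qed

text \<open>
  The second summand of the constant serves the coarse grids: if \<open>h\<close> exceeds the threshold
  \<open>\<tau> / (640 M)\<close>, then \<open>(640 M h / \<tau>)\<^sup>3 \<ge> 1\<close>, and \<open>2 M\<close> bounds the error of any convex combination of samples.
\<close>

lemma F_error_bound:
  assumes "\<tau> > 0" "\<bar>f1 (h * t)\<bar> \<ge> \<tau>" "window t k j"
  shows "\<bar>F k j - f (h * grid_pt k j)\<bar>
          \<le> (2 * (6 * M + (5 * M + 75 * M\<^sup>2) / (\<tau> / 4)) + 2 * M * (640 * M / \<tau>) ^ 3) * h ^ 3"
proof (cases "h \<le> \<tau> / (640 * M)")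
  case True
  have "2 * M * (640 * M / \<tau>) ^ 3 * h ^ 3 \<ge> 0" using M_pos assms(1) h_range by simp
  then show ?thesis using F_third_order[OF assms(1,2) True assms(3)] unfolding distrib_right by linarith
next
  case False
  have "1 \<le> 640 * M / \<tau> * h" using False assms(1) M_pos by (simp add: field_simps)
  then have "1 \<le> (640 * M / \<tau> * h) ^ 3" by (rule one_le_power)
  then have "2 * M * 1 \<le> 2 * M * (640 * M / \<tau> * h) ^ 3" using M_pos by (intro mult_left_mono) auto
  moreover have "2 * (6 * M + (5 * M + 75 * M\<^sup>2) / (\<tau> / 4)) * h ^ 3 \<ge> 0"
    using M_pos assms(1) h_range by simp
  moreover have "\<bar>F k j - f (h * grid_pt k j)\<bar> \<le> 2 * M"
    using F_bound[of k j] f_bound[of "h * grid_pt k j"] by linarith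
  ultimately show ?thesis unfolding distrib_right power_mult_distrib mult.assoc by linarith
qed

end

section \<open>Passage to the limit\<close>

text \<open>
  The point \<open>t\<close> is a grid point of at most one level, so \<open>f_inf\<close> is evaluated there along grid points
  \<open>x k\<close> that converge to \<open>t\<close>.
\<close>

lemma limit_function_error_le:
  assumes lim: "is_limit_function k0 F f_inf" and f: "continuous_on UNIV f"
    and err: "\<And>k j. window t k j \<Longrightarrow> \<bar>F k j - f (grid_pt k j / 2 ^ k0)\<bar> \<le> B"
  shows "\<bar>f_inf (t / 2 ^ k0) - f (t / 2 ^ k0)\<bar> \<le> B"
proof -
  \<comment> \<open>the index of a grid point nearest to \<open>t\<close>\<close>
  define J where "J k = \<lfloor>2 ^ k * t\<rfloor> + 1" for k :: nat
  define x where "x k = grid_pt k (J k)" for k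
  have J: "t \<le> J k / 2 ^ k" "J k / 2 ^ k \<le> t + 1 / 2 ^ k" for k
  proof -
    have "2 ^ k * t \<le> J k" "J k \<le> 2 ^ k * t + 1" unfolding J_def by linarith+
    then show "t \<le> J k / 2 ^ k" "J k / 2 ^ k \<le> t + 1 / 2 ^ k"
      by (simp_all add: field_simps)
  qed
  have x_eq: "x k = J k / 2 ^ k - 1 / 2 ^ k / 2" for k
    by (simp add: x_def grid_pt_def diff_divide_distrib)
  have xt: "\<bar>x k - t\<bar> \<le> 1 / 2 ^ k" for k
    using J[of k] zero_le_divide_1_iff[of "2 ^ k :: real"] unfolding x_eq by (simp add: abs_le_iff)
  have "(\<lambda>k. x k - t) \<longlonglongrightarrow> 0"
  proof (rule Lim_null_comparison)
    show "(\<lambda>k. 1 / 2 ^ k :: real) \<longlonglongrightarrow> 0"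
      using LIMSEQ_power_zero[of "1/2 :: real"] by (simp add: power_one_over)
  qed (use xt in auto)
  then have "x \<longlonglongrightarrow> t" by (simp add: LIM_zero_iff)
  then have arg: "(\<lambda>k. x k / 2 ^ k0) \<longlonglongrightarrow> t / 2 ^ k0" by (intro tendsto_divide tendsto_const) auto
  have win: "window t k (J k)" for k
  proof -
    have "1 / 2 ^ k \<le> 2 / (2 ^ k :: real)" by (intro divide_right_mono) auto
    then show ?thesis using xt[of k] unfolding window_def x_def by linarith
  qed
  have g: "continuous_on UNIV f_inf"
    and sup: "(\<lambda>k. SUP j \<in> {j :: int. real_of_int j \<in> (\<lambda>x. 2 ^ k * x) ` {t..t + 1}}.
               ennreal \<bar>F k j - f_inf (grid_pt k j / 2 ^ k0)\<bar>) \<longlonglongrightarrow> 0"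
    using lim unfolding is_limit_function_def by auto
  have "(\<lambda>k. ennreal \<bar>F k (J k) - f_inf (x k / 2 ^ k0)\<bar>) \<longlonglongrightarrow> 0"
  proof (rule tendsto_sandwich[OF _ _ tendsto_const sup])
    show "\<forall>\<^sub>F k in sequentially. ennreal \<bar>F k (J k) - f_inf (x k / 2 ^ k0)\<bar>
        \<le> (SUP j \<in> {j :: int. real_of_int j \<in> (\<lambda>x. 2 ^ k * x) ` {t..t + 1}}.
               ennreal \<bar>F k j - f_inf (grid_pt k j / 2 ^ k0)\<bar>)"
    proof (intro always_eventually allI)
      fix k
      have "1 / 2 ^ k \<le> (1 :: real)" by simp
      then have "real_of_int (J k) / 2 ^ k \<in> {t..t + 1}"
        using J[of k] unfolding atLeastAtMost_iff by linarith
      then have "real_of_int (J k) \<in> (\<lambda>x. 2 ^ k * x) ` {t..t + 1}"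
        by (intro image_eqI[of _ _ "J k / 2 ^ k"]) auto
      then show "ennreal \<bar>F k (J k) - f_inf (x k / 2 ^ k0)\<bar>
        \<le> (SUP j \<in> {j :: int. real_of_int j \<in> (\<lambda>x. 2 ^ k * x) ` {t..t + 1}}.
               ennreal \<bar>F k j - f_inf (grid_pt k j / 2 ^ k0)\<bar>)"
        unfolding x_def by (intro SUP_upper) simp
    qed
  qed simp
  then have "(\<lambda>k. \<bar>F k (J k) - f_inf (x k / 2 ^ k0)\<bar>) \<longlonglongrightarrow> 0"
    using ennreal_tendsto_0_iff[of "\<lambda>k. \<bar>F k (J k) - f_inf (x k / 2 ^ k0)\<bar>"] by simp
  then have "(\<lambda>k. F k (J k) - f_inf (x k / 2 ^ k0)) \<longlonglongrightarrow> 0" by (rule tendsto_rabs_zero_cancel)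
  moreover have "(\<lambda>k. f_inf (x k / 2 ^ k0)) \<longlonglongrightarrow> f_inf (t / 2 ^ k0)"
    using continuous_on_tendsto_compose[OF g arg] by simp
  ultimately have "(\<lambda>k. F k (J k)) \<longlonglongrightarrow> f_inf (t / 2 ^ k0)"
    using tendsto_add by fastforce
  moreover have "(\<lambda>k. f (x k / 2 ^ k0)) \<longlonglongrightarrow> f (t / 2 ^ k0)"
    using continuous_on_tendsto_compose[OF f arg] by simp
  ultimately have "(\<lambda>k. \<bar>F k (J k) - f (x k / 2 ^ k0)\<bar>) \<longlonglongrightarrow> \<bar>f_inf (t / 2 ^ k0) - f (t / 2 ^ k0)\<bar>"
    by (intro tendsto_rabs tendsto_diff)
  then show ?thesis
    by (rule LIMSEQ_le_const2) (use err[OF win] in \<open>auto simp: x_def\<close>)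
qed

section \<open>Third order accuracy where the derivative is bounded away from zero\<close>

theorem theorem5p7:
  fixes f :: "real \<Rightarrow> real" and \<tau> :: real
  assumes "sobolev_inf 3 f" and "\<tau> > 0"
  shows "\<exists>c>0. \<forall>(k0 :: nat) (\<sigma> :: nat \<Rightarrow> int \<Rightarrow> real) (f0 :: int \<Rightarrow> real) (f_inf :: real \<Rightarrow> real).
           f0 = (\<lambda>n. f ((real_of_int n - 1/2) / 2 ^ k0)) \<longrightarrow>
           (\<forall>k m. \<sigma> k m \<in> {-1, 1}) \<longrightarrow>
           standing_assumptions k0 \<sigma> f0 \<longrightarrow>
           is_limit_function k0 (nucc_data k0 \<sigma> f0) f_inf \<longrightarrow>
           (\<forall>(k :: nat) (j :: int) (t_bar :: real).
              t_bar = grid_pt (k + 1) j / 2 ^ k0 \<longrightarrow>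
              (\<forall>t. \<bar>t - t_bar\<bar> \<le> 1 / 2 ^ (k0 + k) \<longrightarrow> \<bar>deriv f t\<bar> \<ge> \<tau>) \<longrightarrow>
              \<bar>f_inf t_bar - f t_bar\<bar> \<le> c / 2 ^ (3 * k0))"
proof -
  obtain f1 f2 M where smooth: "smooth_data f f1 f2 M"
    using assms(1) by (rule sobolev_inf_3_smooth)
  interpret smooth_data f f1 f2 M by (rule smooth)
  define c where "c = 2 * (6 * M + (5 * M + 75 * M\<^sup>2) / (\<tau> / 4)) + 2 * M * (640 * M / \<tau>) ^ 3"
  have "c > 0" unfolding c_def using M_pos assms(2)
    by (intro add_pos_pos mult_pos_pos divide_pos_pos zero_less_power) auto
  have cont: "continuous_on UNIV f"
    using deriv_f by (auto intro!: continuous_at_imp_continuous_on DERIV_isCont)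
  show ?thesis
  proof (intro exI[of _ c] conjI allI impI)
    show "c > 0" by fact
  next
    fix k0 :: nat and \<sigma> :: "nat \<Rightarrow> int \<Rightarrow> real" and f0 :: "int \<Rightarrow> real" and f_inf :: "real \<Rightarrow> real"
      and k :: nat and j :: int and t_bar :: real
    assume f0: "f0 = (\<lambda>n. f ((real_of_int n - 1/2) / 2 ^ k0))"
      and \<sigma>: "\<forall>k m. \<sigma> k m \<in> {-1, 1}"
      and lim: "is_limit_function k0 (nucc_data k0 \<sigma> f0) f_inf"
      and t_bar: "t_bar = grid_pt (k + 1) j / 2 ^ k0"
      and steep: "\<forall>t. \<bar>t - t_bar\<bar> \<le> 1 / 2 ^ (k0 + k) \<longrightarrow> \<bar>deriv f t\<bar> \<ge> \<tau>"
    interpret nucc_scheme f f1 f2 M k0 \<sigma> by unfold_locales (use \<sigma> in blast)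
    have F: "nucc_data k0 \<sigma> f0 = F" by (simp add: F_def F0_def[abs_def] f0)
    have h: "h * y = y / 2 ^ k0" for y by (simp add: h_def)
    have "\<bar>deriv f t_bar\<bar> \<ge> \<tau>" using steep by simp
    then have "\<bar>f1 (h * grid_pt (k + 1) j)\<bar> \<ge> \<tau>"
      using DERIV_imp_deriv[OF deriv_f, of t_bar] by (simp add: h t_bar)
    then have "\<bar>F l i - f (grid_pt l i / 2 ^ k0)\<bar> \<le> c * h ^ 3"
      if "window (grid_pt (k + 1) j) l i" for l i
      using F_error_bound[OF assms(2) _ that] unfolding c_def h by blast
    then have "\<bar>f_inf t_bar - f t_bar\<bar> \<le> c * h ^ 3"
      unfolding t_bar by (intro limit_function_error_le[OF lim[unfolded F] cont])
    also have "c * h ^ 3 = c / 2 ^ (3 * k0)"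
      by (simp add: h_def power_divide power_mult[symmetric] mult.commute)
    finally show "\<bar>f_inf t_bar - f t_bar\<bar> \<le> c / 2 ^ (3 * k0)" .
  qed
qed

end
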